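(* Let $\mathcal{H}$ be a Hilbert space and let $F=\{f_i\}_{i\in\mathbb{I}}\subset\mathcal{H}$ be a sequence indexed by a countable set $\mathbb{I}$. Then $F$ is a frame for $\mathcal{H}$ if and only if $(F,F)$ is a pair frame for $\mathcal{H}$; and $F$ is a Bessel sequence for $\mathcal{H}$ if and only if $(F,F)$ is a pair Bessel for $\mathcal{H}$.
   Context: A family $F=\{f_i\}_{i\in\mathbb{I}}\subset\mathcal{H}$ is a Bessel sequence for $\mathcal{H}$ if there is $B>0$ such that $\sum_i|\langle f,f_i\rangle|^2\le B\|f\|^2$ for every $f\in\mathcal{H}$; it is a frame for $\mathcal{H}$ if there are $A,B>0$ such that $A\|f\|^2\le\sum_i|\langle f,f_i\rangle|^2\le B\|f\|^2$ for every $f\in\mathcal{H}$. For two sequences $F=\{f_i\}_{i\in\mathbb{I}}$, $G=\{g_i\}_{i\in\mathbb{I}}$ in $\mathcal{H}$, the pair $(G,F)$ is a pair Bessel for $\mathcal{H}$ if the operator $S:\mathcal{H}\to\mathcal{H}$, $S(f)=\sum_i\langle f,g_i\rangle f_i$, is well-defined, i.e. the series converges in $\mathcal{H}$ for every $f\in\mathcal{H}$ (it is then automatically bounded by the uniform boundedness principle). A pair Bessel $(G,F)$ is a pair frame for $\mathcal{H}$ if this operator $S$ is invertible. Series over the countable set $\mathbb{I}$ are norm-convergent series with respect to a fixed enumeration of $\mathbb{I}$. Inner products are linear in the first variable. *)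

theory Defs
  imports "HOL-Analysis.Analysis"
begin

text \<open>
  A Hilbert space may be real or complex. The next class treats both scalar fields at once: by the
  Gelfand--Mazur theorem, the reals and the complex numbers are the only normed fields over the
  reals with multiplicative norm, and \<open>mult_sconj\<close> makes \<open>sconj\<close> the usual conjugation.
\<close>

class rc_field = real_normed_field +
  fixes sconj :: "'a \<Rightarrow> 'a"
  assumes sconj_add: "sconj (x + y) = sconj x + sconj y"
    and mult_sconj: "x * sconj x = (norm x)\<^sup>2 *\<^sub>R 1"

instantiation real :: rc_field
begin
definition sconj_real :: "real \<Rightarrow> real" where "sconj_real x = x"
instance
  by standard (simp_all add: sconj_real_def power2_eq_square)
end

instantiation complex :: rc_field
begin
definition sconj_complex :: "complex \<Rightarrow> complex" where "sconj_complex = cnj"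
instance
  by standard (simp_all add: sconj_complex_def complex_norm_square scaleR_conv_of_real
      del: of_real_power)
end

text \<open>
  Completeness comes from the class \<open>banach\<close>. The axiom \<open>ip_norm\<close> says that the norm of the
  type is the one induced by the inner product, so it contains positive definiteness.
\<close>

locale hilbert_space = vector_space smul
  for smul :: "'k::rc_field \<Rightarrow> 'h::banach \<Rightarrow> 'h" +
  fixes ip :: "'h \<Rightarrow> 'h \<Rightarrow> 'k"
  assumes scale_of_real: "smul (of_real r) x = r *\<^sub>R x"
    and ip_add_left: "ip (x + y) z = ip x z + ip y z"
    and ip_scale_left: "ip (smul c x) y = c * ip x y"
    and ip_commute: "ip y x = sconj (ip x y)"
    and ip_norm: "ip x x = of_real ((norm x)\<^sup>2)"

lemma hilbert_space_real_inner:
  "hilbert_space (scaleR :: real \<Rightarrow> 'a::{real_inner, banach} \<Rightarrow> 'a) inner"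
  by unfold_locales
    (simp_all add: scaleR_add_right scaleR_add_left inner_add_left sconj_real_def
      power2_norm_eq_inner, rule inner_commute)

lemma hilbert_space_complex:
  "hilbert_space ((*) :: complex \<Rightarrow> complex \<Rightarrow> complex) (\<lambda>x y. x * cnj y)"
  by unfold_locales
    (simp_all add: algebra_simps sconj_complex_def scaleR_conv_of_real complex_norm_square
      del: of_real_power)

text \<open>
  An enumeration without repetitions: of the whole of \<open>nat\<close> onto an infinite \<open>I\<close>, and of
  \<open>{..<card I}\<close> onto a finite \<open>I\<close>. In the finite case the values of \<open>e\<close> at larger
  arguments are irrelevant, and the sequence of terms is continued by zeros.
\<close>

definition enumerates :: "(nat \<Rightarrow> 'i) \<Rightarrow> 'i set \<Rightarrow> bool" where
  "enumerates e I \<longleftrightarrow> bij_betw e (if finite I then {..<card I} else UNIV) I"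

lemma countable_iff_enumerates: "countable I \<longleftrightarrow> (\<exists>e. enumerates e I)"
proof
  assume c: "countable I"
  show "\<exists>e. enumerates e I"
  proof (cases "finite I")
    case True
    then show ?thesis
      using ex_bij_betw_nat_finite[of I] by (auto simp: enumerates_def atLeast0LessThan)
  next
    case False
    then show ?thesis
      using bij_betw_from_nat_into[OF c False] by (auto simp: enumerates_def)
  qed
next
  assume "\<exists>e. enumerates e I"
  then obtain e where "e ` (if finite I then {..<card I} else UNIV) = I"
    by (auto simp: enumerates_def bij_betw_def)
  then show "countable I"
    by (metis countable_image countableI_type)
qed

definition enum_term :: "(nat \<Rightarrow> 'i) \<Rightarrow> 'i set \<Rightarrow> ('i \<Rightarrow> 'a::real_normed_vector) \<Rightarrow> nat \<Rightarrow> 'a" where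
  "enum_term e I u k = (if finite I \<longrightarrow> k < card I then u (e k) else 0)"

definition series_converges ::
    "(nat \<Rightarrow> 'i) \<Rightarrow> 'i set \<Rightarrow> ('i \<Rightarrow> 'a::real_normed_vector) \<Rightarrow> bool" where
  "series_converges e I u \<longleftrightarrow> summable (enum_term e I u)"

definition series_sum ::
    "(nat \<Rightarrow> 'i) \<Rightarrow> 'i set \<Rightarrow> ('i \<Rightarrow> 'a::real_normed_vector) \<Rightarrow> 'a" where
  "series_sum e I u = suminf (enum_term e I u)"

text \<open>
  A bound on a series of nonnegative reals includes its convergence, which has to be said
  explicitly because \<open>suminf\<close> is total.
\<close>

definition bessel_sequence ::
    "('h::banach \<Rightarrow> 'h \<Rightarrow> 'k::rc_field) \<Rightarrow> (nat \<Rightarrow> 'i) \<Rightarrow> 'i set \<Rightarrow> ('i \<Rightarrow> 'h) \<Rightarrow> bool" where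
  "bessel_sequence ip e I F \<longleftrightarrow>
    (\<exists>B>0. \<forall>x. series_converges e I (\<lambda>i. (norm (ip x (F i)))\<^sup>2) \<and>
      series_sum e I (\<lambda>i. (norm (ip x (F i)))\<^sup>2) \<le> B * (norm x)\<^sup>2)"

definition is_frame ::
    "('h::banach \<Rightarrow> 'h \<Rightarrow> 'k::rc_field) \<Rightarrow> (nat \<Rightarrow> 'i) \<Rightarrow> 'i set \<Rightarrow> ('i \<Rightarrow> 'h) \<Rightarrow> bool" where
  "is_frame ip e I F \<longleftrightarrow>
    (\<exists>A>0. \<exists>B>0. \<forall>x. series_converges e I (\<lambda>i. (norm (ip x (F i)))\<^sup>2) \<and>
      A * (norm x)\<^sup>2 \<le> series_sum e I (\<lambda>i. (norm (ip x (F i)))\<^sup>2) \<and>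
      series_sum e I (\<lambda>i. (norm (ip x (F i)))\<^sup>2) \<le> B * (norm x)\<^sup>2)"

definition pair_operator ::
    "('k::rc_field \<Rightarrow> 'h::banach \<Rightarrow> 'h) \<Rightarrow> ('h \<Rightarrow> 'h \<Rightarrow> 'k) \<Rightarrow> (nat \<Rightarrow> 'i) \<Rightarrow> 'i set \<Rightarrow>
      ('i \<Rightarrow> 'h) \<Rightarrow> ('i \<Rightarrow> 'h) \<Rightarrow> 'h \<Rightarrow> 'h" where
  "pair_operator smul ip e I G F x = series_sum e I (\<lambda>i. smul (ip x (G i)) (F i))"

definition pair_bessel ::
    "('k::rc_field \<Rightarrow> 'h::banach \<Rightarrow> 'h) \<Rightarrow> ('h \<Rightarrow> 'h \<Rightarrow> 'k) \<Rightarrow> (nat \<Rightarrow> 'i) \<Rightarrow> 'i set \<Rightarrow>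
      ('i \<Rightarrow> 'h) \<Rightarrow> ('i \<Rightarrow> 'h) \<Rightarrow> bool" where
  "pair_bessel smul ip e I G F \<longleftrightarrow>
    (\<forall>x. series_converges e I (\<lambda>i. smul (ip x (G i)) (F i)))"

definition bounded_operator :: "('k::rc_field \<Rightarrow> 'h::banach \<Rightarrow> 'h) \<Rightarrow> ('h \<Rightarrow> 'h) \<Rightarrow> bool" where
  "bounded_operator smul T \<longleftrightarrow> bounded_linear T \<and> (\<forall>c x. T (smul c x) = smul c (T x))"

text \<open>
  Invertibility is meant in the algebra of bounded operators: the inverse is bounded too.
\<close>

definition invertible_operator :: "('k::rc_field \<Rightarrow> 'h::banach \<Rightarrow> 'h) \<Rightarrow> ('h \<Rightarrow> 'h) \<Rightarrow> bool" where
  "invertible_operator smul S \<longleftrightarrow>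
    bounded_operator smul S \<and> (\<exists>T. bounded_operator smul T \<and> T \<circ> S = id \<and> S \<circ> T = id)"

definition pair_frame ::
    "('k::rc_field \<Rightarrow> 'h::banach \<Rightarrow> 'h) \<Rightarrow> ('h \<Rightarrow> 'h \<Rightarrow> 'k) \<Rightarrow> (nat \<Rightarrow> 'i) \<Rightarrow> 'i set \<Rightarrow>
      ('i \<Rightarrow> 'h) \<Rightarrow> ('i \<Rightarrow> 'h) \<Rightarrow> bool" where
  "pair_frame smul ip e I G F \<longleftrightarrow>
    pair_bessel smul ip e I G F \<and> invertible_operator smul (pair_operator smul ip e I G F)"

end

theory Submission
  imports Defs
begin

text \<open>
  If \<open>F\<close> is Bessel with bound \<open>B\<close>, the Cauchy--Schwarz inequality gives
  \<open>\<parallel>\<Sum>\<^sub>k \<langle>x, f\<^sub>k\<rangle> f\<^sub>k\<parallel>\<^sup>2 \<le> B \<Sum>\<^sub>k |\<langle>x, f\<^sub>k\<rangle>|\<^sup>2\<close> over any finite set of indices, hence convergence and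
  boundedness of \<open>S\<close>. Conversely, \<open>\<langle>S\<^sub>n x, x\<rangle> = \<Sum>\<^bsub>k<n\<^esub> |\<langle>x, f\<^sub>k\<rangle>|\<^sup>2\<close> for the partial sums \<open>S\<^sub>n\<close>, which are
  uniformly bounded by the Banach--Steinhaus theorem.

  A lower frame bound \<open>A\<close> makes \<open>S\<close> coercive, \<open>\<langle>S x, x\<rangle> \<ge> A \<parallel>x\<parallel>\<^sup>2\<close>, so \<open>S\<close> is invertible by the
  contraction argument of Lax and Milgram. Conversely, if \<open>S\<close> is invertible, then \<open>\<parallel>x\<parallel>\<close> is controlled by
  \<open>\<parallel>S x\<parallel>\<close>, and \<open>\<parallel>S x\<parallel>\<^sup>2\<close> is at most \<open>B\<close> times the frame sum.
\<close>

section \<open>Uniform boundedness principle\<close>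

lemma banach_steinhaus:
  fixes T :: "'i \<Rightarrow> 'a::banach \<Rightarrow> 'b::real_normed_vector"
  assumes lin: "\<And>i. bounded_linear (T i)"
    and bdd: "\<And>x. bounded (range (\<lambda>i. T i x))"
  obtains M where "M > 0" "\<And>i x. norm (T i x) \<le> M * norm x"
proof -
  define E where "E m = {x. \<forall>i. norm (T i x) \<le> real m}" for m
  have clo: "closed (E m)" for m
  proof -
    have "E m = (\<Inter>i. {x. norm (T i x) \<le> real m})"
      by (auto simp: E_def)
    moreover have "closed {x. norm (T i x) \<le> real m}" for i
      by (intro closed_Collect_le continuous_intros linear_continuous_on lin)
    ultimately show ?thesis
      by auto
  qed
  have cov: "\<Union>(range E) = UNIV"
  proof (intro set_eqI iffI UNIV_I)
    fix x
    obtain b where "\<And>i. norm (T i x) \<le> b"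
      using bdd[of x] by (auto simp: bounded_iff)
    moreover obtain m :: nat where "b \<le> real m"
      using real_arch_simple by blast
    ultimately have "x \<in> E m"
      unfolding E_def using order_trans by blast
    then show "x \<in> \<Union>(range E)" by blast
  qed
  \<comment> \<open>Baire: countably many closed sets with empty interior cannot cover a nonempty
    complete space, yet the sets \<open>E m\<close> do.\<close>
  have "\<exists>m. interior (E m) \<noteq> {}"
  proof (rule ccontr)
    assume "\<not> ?thesis"
    then have "(euclidean :: 'a topology) interior_of \<Union>(range E) = {}"
      by (intro Baire_category_alt disjI1 completely_metrizable_space_euclidean)
        (auto simp: clo)
    then show False
      by (simp add: cov)
  qed
  then obtain m y r where r: "r > 0" and sub: "cball y r \<subseteq> E m"
    by (metis all_not_in_conv mem_interior_cball)
  \<comment> \<open>The ball around \<open>y\<close> is moved to the origin by writing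
    \<open>u\<close> as a difference of two points of \<open>E m\<close>; hence the factor
    2.\<close>
  have small: "norm (T i u) \<le> 2 * real m" if "norm u \<le> r" for i u
  proof -
    have "y + u \<in> E m" "y \<in> E m"
      using that r sub by (auto simp: subset_iff dist_norm)
    then have "norm (T i (y + u)) \<le> real m" "norm (T i y) \<le> real m"
      by (auto simp: E_def)
    moreover have "T i u = T i (y + u) - T i y"
      using lin[of i] by (simp add: bounded_linear.axioms(1) linear_add bounded_linear.linear)
    ultimately show ?thesis
      using norm_triangle_ineq4[of "T i (y + u)" "T i y"] by simp
  qed
  show thesis
  proof
    \<comment> \<open>The summand 1 keeps the constant positive when \<open>m = 0\<close>.\<close>
    show "(2 * real m + 1) / r > 0"
      using r by simp
    fix i x
    show "norm (T i x) \<le> (2 * real m + 1) / r * norm x"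
    proof (cases "x = 0")
      case True
      then show ?thesis
        using lin[of i] by (simp add: linear_0 bounded_linear.linear)
    next
      case False
      have "norm (T i ((r / norm x) *\<^sub>R x)) \<le> 2 * real m"
        using False r by (intro small) simp
      also have "T i ((r / norm x) *\<^sub>R x) = (r / norm x) *\<^sub>R T i x"
        using lin[of i] by (simp add: linear_scale bounded_linear.linear)
      finally have "norm (T i x) \<le> 2 * real m / r * norm x"
        using False r by (simp add: field_simps)
      also have "\<dots> \<le> (2 * real m + 1) / r * norm x"
        using r by (intro mult_right_mono divide_right_mono) auto
      finally show ?thesis .
    qed
  qed
qed

section \<open>Conjugation in the scalar field\<close>

lemma sconj_0 [simp]: "sconj 0 = (0 :: 'k::rc_field)"
  using sconj_add[of "0::'k" 0] by simp

text \<open>For nonzero \<open>x\<close>, \<open>mult_sconj\<close> determines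
  \<open>sconj x\<close>. This and the next two identities follow by multiplying with the nonzero
  argument and cancelling; zero is left to \<open>sconj_0\<close>.\<close>

lemma norm_sconj [simp]: "norm (sconj x) = norm (x :: 'k::rc_field)"
proof (cases "x = 0")
  case False
  have "norm x * norm (sconj x) = norm x * norm x"
    using arg_cong[OF mult_sconj[of x], of norm] by (simp add: norm_mult power2_eq_square)
  with False show ?thesis by simp
qed simp

lemma sconj_of_real [simp]: "sconj (of_real r) = (of_real r :: 'k::rc_field)"
proof (cases "r = 0")
  case False
  have "(of_real r :: 'k) * sconj (of_real r) = of_real r * of_real r"
    using mult_sconj[of "of_real r :: 'k"] by (simp add: power2_eq_square scaleR_conv_of_real)
  with False show ?thesis by simp
qed simp

lemma sconj_mult: "sconj (x * y) = sconj x * sconj (y :: 'k::rc_field)"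
proof (cases "x * y = 0")
  case False
  have "x * y * sconj (x * y) = (x * sconj x) * (y * sconj y)"
    unfolding mult_sconj by (simp add: norm_mult power_mult_distrib scaleR_conv_of_real)
  then have "x * y * sconj (x * y) = x * y * (sconj x * sconj y)"
    by (simp add: mult_ac)
  with False show ?thesis by simp
qed auto

section \<open>Inner product calculus and Cauchy-Schwarz\<close>

context hilbert_space
begin

lemma ip_0_right [simp]: "ip x 0 = 0"
  using ip_commute[of x 0] ip_add_left[of 0 0 x] by simp

lemma ip_add_right: "ip x (y + z) = ip x y + ip x z"
  by (metis ip_add_left ip_commute sconj_add)

lemma ip_scale_right: "ip x (smul c y) = sconj c * ip x y"
  by (metis ip_scale_left ip_commute sconj_mult)

lemma norm_ip_commute: "norm (ip x y) = norm (ip y x)"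
  by (metis ip_commute norm_sconj)

lemma ip_scaleR_left: "ip (r *\<^sub>R x) y = r *\<^sub>R ip x y"
  by (metis ip_scale_left scale_of_real scaleR_conv_of_real)

lemma ip_scaleR_right: "ip x (r *\<^sub>R y) = r *\<^sub>R ip x y"
  by (metis ip_scale_right scale_of_real scaleR_conv_of_real sconj_of_real)

lemma ip_minus_left: "ip (- x) y = - ip x y"
  using ip_scaleR_left[of "-1"] by simp

lemma ip_diff_left: "ip (x - z) y = ip x y - ip z y"
  using ip_add_left[of x "- z" y] by (simp add: ip_minus_left)

lemma ip_diff_right: "ip x (y - z) = ip x y - ip x z"
  using ip_add_right[of x y "- z"] ip_scaleR_right[of x "-1" z] by simp

lemma ip_sum_left: "ip (\<Sum>k\<in>K. u k) y = (\<Sum>k\<in>K. ip (u k) y)"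
proof (induction K rule: infinite_finite_induct)
  case empty
  show ?case using ip_scaleR_left[of 0] by simp
next
  case (infinite K)
  then show ?case using ip_scaleR_left[of 0] by simp
qed (simp add: ip_add_left)

text \<open>The axioms tie \<open>smul\<close> to the norm directly for real scalars only; for
  general ones the link goes through \<open>ip_norm\<close>.\<close>

lemma norm_smul: "norm (smul c x) = norm c * norm x"
proof -
  have "of_real ((norm (smul c x))\<^sup>2) = (c * sconj c) * ip x x"
    by (simp only: ip_norm[symmetric] ip_scale_left ip_scale_right mult_ac)
  also have "\<dots> = of_real ((norm c * norm x)\<^sup>2)"
    by (simp add: mult_sconj ip_norm scaleR_conv_of_real power_mult_distrib)
  finally have "(norm (smul c x))\<^sup>2 = (norm c * norm x)\<^sup>2"
    by (simp only: of_real_eq_iff)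
  then show ?thesis
    by simp
qed

lemma norm_ip_le: "norm (ip x y) \<le> norm x * norm y"
proof (cases "y = 0")
  case False
  \<comment> \<open>\<open>smul c y\<close> is the orthogonal projection of \<open>x\<close> onto
    the line of \<open>y\<close>. The inequality says that the residual has nonnegative squared
    norm.\<close>
  define c where "c = ip x y / of_real ((norm y)\<^sup>2)"
  have c: "c * ip y y = ip x y"
    using False by (simp add: c_def ip_norm)
  have "of_real ((norm (x - smul c y))\<^sup>2) = ip x x - sconj c * ip x y"
  proof -
    have "of_real ((norm (x - smul c y))\<^sup>2) =
        ip x x - sconj c * ip x y - c * ip y x + sconj c * (c * ip y y)"
      by (simp add: ip_norm[symmetric] ip_diff_left ip_diff_right ip_scale_left ip_scale_right
          algebra_simps del: of_real_power)
    \<comment> \<open>Both sides equal \<open>c * sconj c * ip y y\<close>, because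
      \<open>ip y y\<close> is its own conjugate.\<close>
    also have "c * ip y x = sconj c * ip x y"
      using arg_cong[OF c, of sconj] ip_commute[of y x] ip_commute[of y y] c
      by (metis mult.left_commute sconj_mult)
    finally show ?thesis
      using c by simp
  qed
  also have "sconj c = ip y x / of_real ((norm y)\<^sup>2)"
  proof -
    have "sconj c * ip y y = ip y x"
      using arg_cong[OF c, of sconj] ip_commute[of y x] ip_commute[of y y]
      by (simp add: sconj_mult)
    then show ?thesis
      using False by (simp add: ip_norm field_simps)
  qed
  also have "\<dots> * ip x y = of_real ((norm (ip x y))\<^sup>2 / (norm y)\<^sup>2)"
    using mult_sconj[of "ip x y"] ip_commute[of y x]
    by (simp add: scaleR_conv_of_real mult.commute)
  finally have "of_real ((norm (x - smul c y))\<^sup>2) =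
      (of_real ((norm x)\<^sup>2 - (norm (ip x y))\<^sup>2 / (norm y)\<^sup>2) :: 'k)"
    by (simp add: ip_norm)
  then have "(norm (x - smul c y))\<^sup>2 = (norm x)\<^sup>2 - (norm (ip x y))\<^sup>2 / (norm y)\<^sup>2"
    by (simp only: of_real_eq_iff)
  then have "(norm (ip x y))\<^sup>2 / (norm y)\<^sup>2 \<le> (norm x)\<^sup>2"
    by (metis diff_ge_0_iff_ge zero_le_power2)
  then have "(norm (ip x y))\<^sup>2 \<le> (norm x * norm y)\<^sup>2"
    using False by (simp add: field_simps power_mult_distrib)
  then show ?thesis
    by (rule power2_le_imp_le) simp
qed simp

lemma bounded_linear_ip_left: "bounded_linear (\<lambda>x. ip x y)"
  by (rule bounded_linear_intro[where K = "norm y"])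
    (simp_all add: ip_add_left ip_scaleR_left norm_ip_le)

lemma smul_scaleR: "smul c (r *\<^sub>R x) = r *\<^sub>R smul c x"
  by (simp flip: scale_of_real add: mult.commute)

lemma smul_scaleR_left: "smul (r *\<^sub>R c) x = r *\<^sub>R smul c x"
  by (simp flip: scale_of_real add: scaleR_conv_of_real)

lemma bounded_linear_smul: "bounded_linear (smul c)"
  by (rule bounded_linear_intro[where K = "norm c"])
    (simp_all add: scale_right_distrib smul_scaleR norm_smul)

lemma norm_diff_squared:
  "of_real ((norm (x - y))\<^sup>2) = of_real ((norm x)\<^sup>2 + (norm y)\<^sup>2) - (ip x y + ip y x)"
  by (simp add: ip_norm[symmetric] ip_diff_left ip_diff_right del: of_real_power)

section \<open>Bessel bounds and the expansion series\<close>

lemma bessel_partial_sum: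
  fixes g :: "nat \<Rightarrow> 'h"
  assumes B: "\<And>x n. (\<Sum>k<n. (norm (ip x (g k)))\<^sup>2) \<le> B * (norm x)\<^sup>2"
    and "B > 0" and K: "finite K"
  shows "(norm (\<Sum>k\<in>K. smul (ip x (g k)) (g k)))\<^sup>2 \<le> B * (\<Sum>k\<in>K. (norm (ip x (g k)))\<^sup>2)"
proof -
  define v where "v = (\<Sum>k\<in>K. smul (ip x (g k)) (g k))"
  define s where "s = (\<Sum>k\<in>K. (norm (ip x (g k)))\<^sup>2)"
  have s0: "s \<ge> 0"
    unfolding s_def by (intro sum_nonneg) simp
  \<comment> \<open>The hypothesis bounds initial segments, whereas \<open>K\<close> may be a block
    \<open>m..<n\<close> of a Cauchy tail.\<close>
  obtain n where n: "K \<subseteq> {..<n}"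
    using K by (auto simp: finite_nat_iff_bounded)
  have "(norm v)\<^sup>2 = norm (ip v v)"
    by (simp add: ip_norm norm_power)
  also have "\<dots> \<le> (\<Sum>k\<in>K. norm (ip x (g k)) * norm (ip v (g k)))"
  proof -
    have "ip v v = (\<Sum>k\<in>K. ip (smul (ip x (g k)) (g k)) v)"
      unfolding ip_sum_left[symmetric] by (simp flip: v_def)
    also have "norm \<dots> \<le> (\<Sum>k\<in>K. norm (ip (smul (ip x (g k)) (g k)) v))"
      by (rule norm_sum)
    finally show ?thesis
      by (simp add: ip_scale_left norm_mult norm_ip_commute[of "g _" v])
  qed
  finally have "((norm v)\<^sup>2)\<^sup>2 \<le> (\<Sum>k\<in>K. norm (ip x (g k)) * norm (ip v (g k)))\<^sup>2"
    by (intro power_mono) auto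
  also have "\<dots> \<le> s * (\<Sum>k\<in>K. (norm (ip v (g k)))\<^sup>2)"
    unfolding s_def by (rule Cauchy_Schwarz_ineq_sum)
  also have "\<dots> \<le> s * (\<Sum>k<n. (norm (ip v (g k)))\<^sup>2)"
    using n s0 by (intro mult_left_mono sum_mono2) auto
  \<comment> \<open>The Bessel bound is applied to the sum \<open>v\<close> itself, not to
    \<open>x\<close>; one factor \<open>(norm v)\<^sup>2\<close> then cancels.\<close>
  also have "\<dots> \<le> s * (B * (norm v)\<^sup>2)"
    by (intro mult_left_mono B s0)
  finally have "(norm v)\<^sup>2 * (norm v)\<^sup>2 \<le> (B * s) * (norm v)\<^sup>2"
    by (simp add: power2_eq_square mult_ac)
  then have "(norm v)\<^sup>2 \<le> B * s"
    using s0 \<open>B > 0\<close> by (cases "v = 0") (simp_all only: mult_le_cancel_right, simp_all)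
  then show ?thesis
    by (simp add: v_def s_def)
qed

text \<open>Cauchy criterion: by \<open>bessel_partial_sum\<close>, the tails of the vector series
  are controlled by those of a convergent series of nonnegative reals.\<close>

lemma summable_expansion:
  assumes B: "\<And>x n. (\<Sum>k<n. (norm (ip x (g k)))\<^sup>2) \<le> B * (norm x)\<^sup>2" and "B > 0"
  shows "summable (\<lambda>k. smul (ip x (g k)) (g k))"
  unfolding summable_Cauchy
proof (intro allI impI)
  fix r :: real
  assume r: "r > 0"
  have "summable (\<lambda>k. (norm (ip x (g k)))\<^sup>2)"
    by (rule summableI_nonneg_bounded[OF _ B]) simp
  then obtain N where N: "\<And>m n. m \<ge> N \<Longrightarrow> norm (\<Sum>k=m..<n. (norm (ip x (g k)))\<^sup>2) < r\<^sup>2 / B"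
    unfolding summable_Cauchy using r \<open>B > 0\<close> by (metis divide_pos_pos zero_less_power)
  have "norm (\<Sum>k=m..<n. smul (ip x (g k)) (g k)) < r" if "m \<ge> N" for m n
  proof -
    have "(norm (\<Sum>k=m..<n. smul (ip x (g k)) (g k)))\<^sup>2 \<le> B * (\<Sum>k=m..<n. (norm (ip x (g k)))\<^sup>2)"
      by (rule bessel_partial_sum[OF B \<open>B > 0\<close>]) simp
    also have "\<dots> < r\<^sup>2"
      using order.strict_trans1[OF abs_ge_self N[OF that, of n, unfolded real_norm_def]] \<open>B > 0\<close>
      by (simp add: pos_less_divide_eq mult.commute)
    finally show ?thesis
      using r by (simp add: power2_less_imp_less)
  qed
  then show "\<exists>N. \<forall>m\<ge>N. \<forall>n. norm (\<Sum>k=m..<n. smul (ip x (g k)) (g k)) < r"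
    by blast
qed

lemma ip_smul_ip_self: "ip (smul (ip x y) y) x = of_real ((norm (ip x y))\<^sup>2)"
  using mult_sconj[of "ip x y"] ip_commute[of y x] by (simp add: ip_scale_left scaleR_conv_of_real)

text \<open>Continuity of \<open>ip\<close> in its first argument lets it pass through the series,
  turning each term into a squared coefficient.\<close>

lemma ip_expansion:
  assumes "summable (\<lambda>k. smul (ip x (g k)) (g k))"
  shows "(\<lambda>k. (norm (ip x (g k)))\<^sup>2) sums norm (ip (\<Sum>k. smul (ip x (g k)) (g k)) x)"
    and "ip (\<Sum>k. smul (ip x (g k)) (g k)) x = of_real (\<Sum>k. (norm (ip x (g k)))\<^sup>2)"
proof -
  have "(\<lambda>k. ip (smul (ip x (g k)) (g k)) x) sums ip (\<Sum>k. smul (ip x (g k)) (g k)) x"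
    by (rule bounded_linear.sums[OF bounded_linear_ip_left summable_sums[OF assms]])
  then have *: "(\<lambda>k. of_real ((norm (ip x (g k)))\<^sup>2)) sums
      ip (\<Sum>k. smul (ip x (g k)) (g k)) x"
    by (simp only: ip_smul_ip_self)
  \<comment> \<open>The limit is so far known only in the scalar field. Taking norms brings it to
    the reals and leaves the nonnegative partial sums unchanged.\<close>
  then have "(\<lambda>n. norm (\<Sum>k<n. of_real ((norm (ip x (g k)))\<^sup>2) :: 'k)) \<longlonglongrightarrow>
      norm (ip (\<Sum>k. smul (ip x (g k)) (g k)) x)"
    unfolding sums_def by (rule tendsto_norm)
  moreover have "norm (\<Sum>k<n. of_real ((norm (ip x (g k)))\<^sup>2) :: 'k) =
      (\<Sum>k<n. (norm (ip x (g k)))\<^sup>2)" for n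
    by (simp flip: of_real_sum of_real_power add: sum_nonneg)
  ultimately show **: "(\<lambda>k. (norm (ip x (g k)))\<^sup>2) sums norm (ip (\<Sum>k. smul (ip x (g k)) (g k)) x)"
    by (simp add: sums_def)
  show "ip (\<Sum>k. smul (ip x (g k)) (g k)) x = of_real (\<Sum>k. (norm (ip x (g k)))\<^sup>2)"
    using sums_unique2[OF * sums_of_real[OF summable_sums[OF sums_summable[OF **]]]] .
qed

text \<open>Uniform boundedness is applied to the partial sums \<open>S n\<close>, which are bounded
  operators one by one and converge pointwise; pairing \<open>S n x\<close> with \<open>x\<close>
  gives a bound independent of \<open>n\<close>.\<close>

lemma bessel_bound_of_summable:
  assumes sm: "\<And>x. summable (\<lambda>k. smul (ip x (g k)) (g k))"
  obtains B where "B > 0" "\<And>x n. (\<Sum>k<n. (norm (ip x (g k)))\<^sup>2) \<le> B * (norm x)\<^sup>2"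
proof -
  define S where "S n x = (\<Sum>k<n. smul (ip x (g k)) (g k))" for n :: nat and x
  have "bounded_linear (\<lambda>x. smul (ip x (g k)) (g k))" for k
    by (rule bounded_linear_intro[where K = "norm (g k) * norm (g k)"])
      (auto simp: ip_add_left scale_left_distrib ip_scaleR_left norm_smul smul_scaleR_left
        mult.assoc[symmetric] intro!: mult_right_mono norm_ip_le)
  then have lin: "bounded_linear (S n)" for n
    unfolding S_def by (intro bounded_linear_sum)
  have "bounded (range (\<lambda>n. S n x))" for x
    using sm[of x] unfolding S_def summable_iff_convergent
    by (metis convergent_imp_Bseq Bseq_eq_bounded)
  then obtain M where M: "M > 0" "\<And>n x. norm (S n x) \<le> M * norm x"
    using banach_steinhaus[of S, OF lin] by blast
  show thesis
  proof
    fix x n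
    have "ip (S n x) x = (\<Sum>k<n. of_real ((norm (ip x (g k)))\<^sup>2))"
      unfolding S_def ip_sum_left ip_smul_ip_self ..
    then have "(\<Sum>k<n. (norm (ip x (g k)))\<^sup>2) = norm (ip (S n x) x)"
      by (simp flip: of_real_sum of_real_power add: sum_nonneg)
    also have "\<dots> \<le> M * norm x * norm x"
      using norm_ip_le[of "S n x" x] M(2)[of n x] by (meson mult_right_mono norm_ge_zero order_trans)
    finally show "(\<Sum>k<n. (norm (ip x (g k)))\<^sup>2) \<le> M * (norm x)\<^sup>2"
      by (simp add: power2_eq_square mult.assoc)
  qed (rule M(1))
qed

text \<open>The second claim keeps the frame sum on the right instead of \<open>norm x\<close>: this
  is what later yields a lower frame bound from invertibility.\<close>

lemma bounded_operator_expansion: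
  assumes B: "\<And>x n. (\<Sum>k<n. (norm (ip x (g k)))\<^sup>2) \<le> B * (norm x)\<^sup>2" and "B > 0"
  defines "S \<equiv> \<lambda>x. \<Sum>k. smul (ip x (g k)) (g k)"
  shows "bounded_operator smul S"
    and "(norm (S x))\<^sup>2 \<le> B * (\<Sum>k. (norm (ip x (g k)))\<^sup>2)"
    and "norm (S x) \<le> B * norm x"
proof -
  note sm = summable_expansion[OF B \<open>B > 0\<close>]
  show sq: "(norm (S x))\<^sup>2 \<le> B * (\<Sum>k. (norm (ip x (g k)))\<^sup>2)" for x
  proof (rule LIMSEQ_le)
    show "(\<lambda>n. (norm (\<Sum>k<n. smul (ip x (g k)) (g k)))\<^sup>2) \<longlonglongrightarrow> (norm (S x))\<^sup>2"
      unfolding S_def by (intro tendsto_intros summable_LIMSEQ sm)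
    show "(\<lambda>n. B * (\<Sum>k<n. (norm (ip x (g k)))\<^sup>2)) \<longlonglongrightarrow> B * (\<Sum>k. (norm (ip x (g k)))\<^sup>2)"
      by (intro tendsto_intros summable_LIMSEQ sums_summable[OF ip_expansion(1)[OF sm]])
    show "\<exists>N. \<forall>n\<ge>N. (norm (\<Sum>k<n. smul (ip x (g k)) (g k)))\<^sup>2 \<le>
        B * (\<Sum>k<n. (norm (ip x (g k)))\<^sup>2)"
      using bessel_partial_sum[OF B \<open>B > 0\<close>] by blast
  qed
  show nrm: "norm (S x) \<le> B * norm x" for x
  proof -
    have "(\<Sum>k. (norm (ip x (g k)))\<^sup>2) \<le> B * (norm x)\<^sup>2"
      by (rule suminf_le_const[OF sums_summable[OF ip_expansion(1)[OF sm]] B])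
    then have "(norm (S x))\<^sup>2 \<le> B * (B * (norm x)\<^sup>2)"
      using sq[of x] \<open>B > 0\<close> by (meson mult_left_mono less_imp_le order_trans)
    then have "(norm (S x))\<^sup>2 \<le> (B * norm x)\<^sup>2"
      by (simp add: power2_eq_square mult_ac)
    then show ?thesis
      by (rule power2_le_imp_le) (use \<open>B > 0\<close> in simp)
  qed
  have smul: "S (smul c x) = smul c (S x)" for c x
    unfolding S_def using bounded_linear.suminf[OF bounded_linear_smul sm]
    by (simp add: ip_scale_left)
  have "S (r *\<^sub>R x) = r *\<^sub>R S x" for r x
    using smul[of "of_real r"] by (simp add: scale_of_real)
  moreover have "S (x + y) = S x + S y" for x y
    unfolding S_def by (simp add: suminf_add[OF sm sm] ip_add_left scale_left_distrib)
  ultimately have "bounded_linear S"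
    by (intro bounded_linear_intro[where K = B]) (use nrm in \<open>simp_all add: mult.commute\<close>)
  with smul show "bounded_operator smul S"
    by (simp add: bounded_operator_def)
qed

section \<open>Lower frame bounds and invertibility\<close>

lemma invertible_operator_of_coercive:
  assumes S: "bounded_operator smul S" and "A > 0"
    and S_pos: "\<And>x. \<exists>t. ip (S x) x = of_real t \<and> A * (norm x)\<^sup>2 \<le> t"
  shows "invertible_operator smul S"
proof -
  have linS: "bounded_linear S" and smulS: "\<And>c x. S (smul c x) = smul c (S x)"
    using S by (auto simp: bounded_operator_def)
  interpret S: bounded_linear S by (rule linS)
  \<comment> \<open>Coercivity with Cauchy-Schwarz. This gives injectivity now and the bound
    \<open>1 / A\<close> for the inverse later.\<close>
  have lower: "A * norm x \<le> norm (S x)" for x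
  proof (cases "x = 0")
    case False
    obtain t where t: "ip (S x) x = of_real t" "A * (norm x)\<^sup>2 \<le> t"
      using S_pos by blast
    then have "t \<le> norm (S x) * norm x"
      using norm_ip_le[of "S x" x] by simp
    with t have "(A * norm x) * norm x \<le> norm (S x) * norm x"
      by (simp add: power2_eq_square mult.assoc)
    with False show ?thesis by simp
  qed (simp add: S.zero)
  have inj: "x = y" if "S x = S y" for x y
    using lower[of "x - y"] that \<open>A > 0\<close> by (simp add: S.diff mult_le_0_iff)
  obtain C' where C': "C' > 0" "\<And>x. norm (S x) \<le> norm x * C'"
    using S.pos_bounded by blast
  \<comment> \<open>Adding \<open>A\<close> secures \<open>A \<le> C\<close>, hence
    \<open>0 \<le> q\<close>, even in the zero space.\<close>
  define C where "C = C' + A"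
  have C: "C > 0" "A \<le> C" "norm (S x) \<le> C * norm x" for x
  proof -
    have "norm (S x) \<le> C' * norm x + A * norm x"
      using C'(2)[of x] \<open>A > 0\<close> by (simp add: mult.commute add_increasing2)
    then show "norm (S x) \<le> C * norm x"
      by (simp add: C_def distrib_right)
  qed (use C'(1) \<open>A > 0\<close> in \<open>simp_all add: C_def\<close>)
  \<comment> \<open>This value minimizes
    \<open>1 - 2 * \<rho> * A + \<rho>\<^sup>2 * C\<^sup>2\<close>, and \<open>q\<close> is the
    minimum.\<close>
  define \<rho> where "\<rho> = A / C\<^sup>2"
  define q where "q = 1 - (A / C)\<^sup>2"
  have \<rho>: "\<rho> > 0"
    using \<open>A > 0\<close> C(1) by (simp add: \<rho>_def)
  have q: "0 \<le> q" "q < 1"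
    using \<open>A > 0\<close> C by (auto simp: q_def power_le_one_iff)
  have contr: "(norm (x - \<rho> *\<^sub>R S x))\<^sup>2 \<le> q * (norm x)\<^sup>2" for x
  proof -
    obtain t where t: "ip (S x) x = of_real t" "A * (norm x)\<^sup>2 \<le> t"
      using S_pos by blast
    \<comment> \<open>Since \<open>ip (S x) x\<close> is real, the two cross terms in
      \<open>norm_diff_squared\<close> agree and together contribute
      \<open>2 * \<rho> * t\<close>.\<close>
    then have "ip x (S x) = of_real t"
      using ip_commute[of x "S x"] by simp
    with t have "of_real ((norm (x - \<rho> *\<^sub>R S x))\<^sup>2) =
        (of_real ((norm x)\<^sup>2 + \<rho>\<^sup>2 * (norm (S x))\<^sup>2 - 2 * \<rho> * t) :: 'k)"
      unfolding norm_diff_squared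
      by (simp add: ip_scaleR_left ip_scaleR_right scaleR_conv_of_real power_mult_distrib
          flip: of_real_power)
    then have "(norm (x - \<rho> *\<^sub>R S x))\<^sup>2 = (norm x)\<^sup>2 + \<rho>\<^sup>2 * (norm (S x))\<^sup>2 - 2 * \<rho> * t"
      by (simp only: of_real_eq_iff)
    also have "\<dots> \<le> (norm x)\<^sup>2 + \<rho>\<^sup>2 * (C * norm x)\<^sup>2 - 2 * \<rho> * (A * (norm x)\<^sup>2)"
      using t \<rho> C(3)[of x] by (intro diff_mono add_mono mult_left_mono power_mono) auto
    also have "\<dots> = q * (norm x)\<^sup>2"
      using C(1) by (simp add: \<rho>_def q_def field_simps power2_eq_square)
    finally show ?thesis .
  qed
  have surj: "\<exists>x. S x = y" for y
  proof -
    \<comment> \<open>The fixed points are the solutions of \<open>S x = y\<close>. In differences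
      of values \<open>y\<close> cancels, so \<open>contr\<close> makes the map a contraction with
      factor \<open>sqrt q\<close>.\<close>
    have "\<exists>!x. x - \<rho> *\<^sub>R (S x - y) = x"
    proof (rule banach_fix_type)
      show "0 \<le> sqrt q" "sqrt q < 1"
        using q by auto
      have "norm (x - \<rho> *\<^sub>R S x) \<le> sqrt q * norm x" for x
        using real_sqrt_le_mono[OF contr[of x]] by (simp add: real_sqrt_mult)
      from this[of "_ - _"]
      show "\<forall>x z. dist (x - \<rho> *\<^sub>R (S x - y)) (z - \<rho> *\<^sub>R (S z - y)) \<le> sqrt q * dist x z"
        by (simp add: dist_norm S.diff algebra_simps)
    qed
    then show ?thesis
      using \<rho> by auto
  qed
  define T where "T = inv S"
  have bij: "bij S"
    using inj surj by (metis bijI')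
  have ST: "S (T y) = y" for y
    using bij by (simp add: T_def bij_is_surj surj_f_inv_f)
  have TS: "T (S x) = x" for x
    using bij by (simp add: T_def bij_is_inj)
  have smulT: "T (smul c y) = smul c (T y)" for c y
    by (rule inj) (simp add: ST smulS)
  have "bounded_linear T"
  proof (rule bounded_linear_intro)
    show "T (x + y) = T x + T y" for x y
      by (rule inj) (simp add: ST S.add)
    show "T (r *\<^sub>R x) = r *\<^sub>R T x" for r x
      by (rule inj) (simp add: ST S.scaleR)
    show "norm (T x) \<le> norm x * (1 / A)" for x
      using lower[of "T x"] \<open>A > 0\<close> by (simp add: ST field_simps)
  qed
  then have "bounded_operator smul T"
    using smulT by (simp add: bounded_operator_def)
  then show ?thesis
    unfolding invertible_operator_def using S ST TS by (auto simp: fun_eq_iff)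
qed

lemma lower_bound_of_invertible:
  assumes B: "\<And>x n. (\<Sum>k<n. (norm (ip x (g k)))\<^sup>2) \<le> B * (norm x)\<^sup>2" and "B > 0"
    and inv: "invertible_operator smul (\<lambda>x. \<Sum>k. smul (ip x (g k)) (g k))"
  obtains A where "A > 0" "\<And>x. A * (norm x)\<^sup>2 \<le> (\<Sum>k. (norm (ip x (g k)))\<^sup>2)"
proof -
  define S where "S x = (\<Sum>k. smul (ip x (g k)) (g k))" for x
  from inv obtain T where "bounded_linear T" and T: "T (S x) = x" for x
    by (auto simp: invertible_operator_def bounded_operator_def S_def fun_eq_iff)
  then obtain M where M: "M > 0" "\<And>x. norm (T x) \<le> norm x * M"
    using bounded_linear.pos_bounded by blast
  show thesis
  proof
    \<comment> \<open>\<open>M\<close> bounds the inverse, so \<open>(norm x)\<^sup>2\<close> is at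
      most \<open>M\<^sup>2 * (norm (S x))\<^sup>2\<close>, and \<open>B\<close> compares the latter
      with the frame sum.\<close>
    show "1 / (B * M\<^sup>2) > 0"
      using M \<open>B > 0\<close> by simp
    fix x
    have "norm x \<le> norm (S x) * M"
      using M(2)[of "S x"] by (simp add: T)
    then have "(norm x)\<^sup>2 \<le> (norm (S x))\<^sup>2 * M\<^sup>2"
      by (metis norm_ge_zero power_mono power_mult_distrib)
    also have "\<dots> \<le> B * (\<Sum>k. (norm (ip x (g k)))\<^sup>2) * M\<^sup>2"
      unfolding S_def by (intro mult_right_mono bounded_operator_expansion[OF B \<open>B > 0\<close>]) simp
    finally show "1 / (B * M\<^sup>2) * (norm x)\<^sup>2 \<le> (\<Sum>k. (norm (ip x (g k)))\<^sup>2)"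
      using M \<open>B > 0\<close> by (simp add: field_simps)
  qed
qed

end

section \<open>The equivalences for an enumerated family\<close>

theorem proposition2p6:
  fixes smul :: "'k::rc_field \<Rightarrow> 'h::banach \<Rightarrow> 'h"
    and ip :: "'h \<Rightarrow> 'h \<Rightarrow> 'k"
    and e :: "nat \<Rightarrow> 'i" and I :: "'i set" and F :: "'i \<Rightarrow> 'h"
  assumes "hilbert_space smul ip"
    and "countable I" and "enumerates e I"
  shows "(is_frame ip e I F \<longleftrightarrow> pair_frame smul ip e I F F) \<and>
    (bessel_sequence ip e I F \<longleftrightarrow> pair_bessel smul ip e I F F)"
proof -
  interpret hilbert_space smul ip by fact
  \<comment> \<open>A finite family is continued by zero vectors, which add nothing to either
    series; every series now runs over \<open>nat\<close>.\<close>
  define g where "g = enum_term e I F"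
  define S where "S x = (\<Sum>k. smul (ip x (g k)) (g k))" for x
  have sq: "enum_term e I (\<lambda>i. (norm (ip x (F i)))\<^sup>2) = (\<lambda>k. (norm (ip x (g k)))\<^sup>2)" for x
    by (auto simp: g_def enum_term_def)
  have ex: "enum_term e I (\<lambda>i. smul (ip x (F i)) (F i)) = (\<lambda>k. smul (ip x (g k)) (g k))" for x
    by (auto simp: g_def enum_term_def)
  have op: "pair_operator smul ip e I F F = S"
    by (auto simp: pair_operator_def series_sum_def ex S_def)
  \<comment> \<open>For nonnegative terms, convergence with sum at most \<open>b\<close> amounts to
    all partial sums being at most \<open>b\<close>, the form used by the lemmas above.\<close>
  have bessel: "bessel_sequence ip e I F \<longleftrightarrow>
      (\<exists>B>0. \<forall>x n. (\<Sum>k<n. (norm (ip x (g k)))\<^sup>2) \<le> B * (norm x)\<^sup>2)"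
    (is "_ \<longleftrightarrow> (\<exists>B>0. ?bound B)")
  proof -
    have "(\<forall>n. (\<Sum>k<n. (norm (ip x (g k)))\<^sup>2) \<le> b) \<longleftrightarrow>
        summable (\<lambda>k. (norm (ip x (g k)))\<^sup>2) \<and> (\<Sum>k. (norm (ip x (g k)))\<^sup>2) \<le> b" for x b
    proof safe
      assume b: "\<forall>n. (\<Sum>k<n. (norm (ip x (g k)))\<^sup>2) \<le> b"
      show sm: "summable (\<lambda>k. (norm (ip x (g k)))\<^sup>2)"
        by (rule summableI_nonneg_bounded[of _ b]) (use b in auto)
      show "(\<Sum>k. (norm (ip x (g k)))\<^sup>2) \<le> b"
        using suminf_le_const[OF sm] b by blast
    next
      fix n
      assume "summable (\<lambda>k. (norm (ip x (g k)))\<^sup>2)" "(\<Sum>k. (norm (ip x (g k)))\<^sup>2) \<le> b"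
      then show "(\<Sum>k<n. (norm (ip x (g k)))\<^sup>2) \<le> b"
        using sum_le_suminf[of "\<lambda>k. (norm (ip x (g k)))\<^sup>2" "{..<n}"] by simp
    qed
    then show ?thesis
      by (simp add: bessel_sequence_def series_converges_def series_sum_def sq)
  qed
  have pair: "pair_bessel smul ip e I F F \<longleftrightarrow> (\<exists>B>0. ?bound B)"
    unfolding pair_bessel_def series_converges_def ex
  proof
    assume "\<forall>x. summable (\<lambda>k. smul (ip x (g k)) (g k))"
    then show "\<exists>B>0. ?bound B"
      using bessel_bound_of_summable[of g] by blast
  qed (blast intro: summable_expansion)
  have frame: "is_frame ip e I F \<longleftrightarrow> bessel_sequence ip e I F \<and>
      (\<exists>A>0. \<forall>x. A * (norm x)\<^sup>2 \<le> (\<Sum>k. (norm (ip x (g k)))\<^sup>2))"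
    by (auto simp: is_frame_def bessel_sequence_def series_converges_def series_sum_def sq)
  \<comment> \<open>Both sides of the frame equivalence include the Bessel condition, so only the
    lower bound and invertibility remain to be compared, with a Bessel bound \<open>B\<close> at
    hand.\<close>
  have "(\<exists>A>0. \<forall>x. A * (norm x)\<^sup>2 \<le> (\<Sum>k. (norm (ip x (g k)))\<^sup>2)) \<longleftrightarrow>
      invertible_operator smul S" (is "?lower \<longleftrightarrow> _") if "B > 0" "?bound B" for B
  proof
    have B: "(\<Sum>k<n. (norm (ip x (g k)))\<^sup>2) \<le> B * (norm x)\<^sup>2" for x n
      using that by blast
    note sm = summable_expansion[OF B \<open>B > 0\<close>]
    show "invertible_operator smul S" if ?lower
    proof -
      from that obtain A where "A > 0" "\<And>x. A * (norm x)\<^sup>2 \<le> (\<Sum>k. (norm (ip x (g k)))\<^sup>2)"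
        by blast
      \<comment> \<open>The real number \<open>t\<close> of the coercivity hypothesis is the frame
        sum, by \<open>ip_expansion(2)\<close>.\<close>
      then show ?thesis
        unfolding S_def using ip_expansion(2)[OF sm]
        by (intro invertible_operator_of_coercive[OF bounded_operator_expansion(1)[OF B \<open>B > 0\<close>]])
          auto
    qed
    show ?lower if "invertible_operator smul S"
      using lower_bound_of_invertible[OF B \<open>B > 0\<close>] that unfolding S_def by metis
  qed
  then show ?thesis
    unfolding frame pair_frame_def op bessel pair by blast
qed

end
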